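(* Let $f:(X,d)\to(Y,\rho)$ be a function between two metric spaces. The following are equivalent. (a) $f$ is TB-regular. (b) For every metric space $(Z,\mu)$ and every TB-regular function $g:(Y,\rho)\to(Z,\mu)$, the composition $g\circ f$ is TB-regular. (c) For every metric space $(Z,\mu)$ and every Cauchy-continuous function $g:(Y,\rho)\to(Z,\mu)$, the composition $g\circ f$ is TB-regular. (d) For every metric space $(Z,\mu)$ and every Cauchy-Lipschitz function $g:(Y,\rho)\to(Z,\mu)$, the composition $g\circ f$ is TB-regular. (e) For every metric space $(Z,\mu)$ and every uniformly locally Lipschitz function $g:(Y,\rho)\to(Z,\mu)$, the composition $g\circ f$ is TB-regular. (f) For every uniformly locally Lipschitz function $g:(Y,\rho)\to\mathbb{R}$, the composition $g\circ f$ is TB-regular.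
   Context: A subset $A$ of a metric space $(X,d)$ is totally bounded if for every $\epsilon>0$ there is a finite set $\{x_1,\dots,x_n\}\subseteq X$ with $A\subseteq\bigcup_{i=1}^n B(x_i,\epsilon)$, where $B(x,\epsilon)$ is the open ball. Let $h:(X,d)\to(Y,\rho)$ be a (not necessarily continuous) function between metric spaces. - $h$ is TB-regular if $h(A)$ is totally bounded for every totally bounded subset $A$ of $X$. - $h$ is Cauchy-continuous if $(h(x_n))$ is Cauchy in $(Y,\rho)$ for every Cauchy sequence $(x_n)$ in $(X,d)$. - $h$ is Cauchy-Lipschitz if $h$ is Lipschitz when restricted to the range $\{x_n:n\in\mathbb{N}\}$ of each Cauchy sequence $(x_n)$ in $X$. - $h$ is uniformly locally Lipschitz if there exists $\delta>0$ such that for every $x\in X$ there exists $k_x>0$ such that $\rho(h(u),h(w))\le k_x d(u,w)$ whenever $u,w\in B(x,\delta)$. $\mathbb{R}$ carries its usual metric. *)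

theory Defs
  imports "HOL-Analysis.Analysis"
begin

text \<open>
  Metric spaces are elements of \<^typ>\<open>'a metric\<close>, i.e. carrier sets with a distance; a carrier may be a
  proper subset of its type and may be empty. A function between metric spaces is a HOL function that
  maps carrier into carrier; its values outside the carrier are irrelevant.

  The formula \<open>\<forall>Z\<close> cannot range over types. Metric spaces \<open>Z\<close> that are quantified universally
  inside a formula therefore have carriers in a type \<^typ>\<open>'z + real\<close> with \<^typ>\<open>'z\<close> an
  unconstrained type variable: by instantiating \<^typ>\<open>'z\<close>, every metric space (on any type) occurs
  up to isometry, through \<^const>\<open>Inl\<close>. The summand \<^typ>\<open>real\<close> guarantees that (an isometric copy of)
  the real line is always among them. Over a type that is too small, such as \<^typ>\<open>unit\<close>, a
  condition quantifying over all \<open>Z\<close> would hold vacuously.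
\<close>

text \<open>
  The library's \<^const>\<open>Metric_space.mtotally_bounded\<close> takes the centres of the balls in the subset
  itself. Allowing centres anywhere in the space gives the same notion:
\<close>

lemma (in Metric_space) mtotally_bounded_iff_centres_in_space:
  "mtotally_bounded S \<longleftrightarrow>
     S \<subseteq> M \<and> (\<forall>\<epsilon>>0. \<exists>K. finite K \<and> K \<subseteq> M \<and> S \<subseteq> (\<Union>x\<in>K. mball x \<epsilon>))"
proof
  assume "mtotally_bounded S"
  then show "S \<subseteq> M \<and> (\<forall>\<epsilon>>0. \<exists>K. finite K \<and> K \<subseteq> M \<and> S \<subseteq> (\<Union>x\<in>K. mball x \<epsilon>))"
    using mtotally_bounded_imp_subset[of S] unfolding mtotally_bounded_def
    by (meson subset_trans)
next
  assume R: "S \<subseteq> M \<and> (\<forall>\<epsilon>>0. \<exists>K. finite K \<and> K \<subseteq> M \<and> S \<subseteq> (\<Union>x\<in>K. mball x \<epsilon>))"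
  show "mtotally_bounded S"
    unfolding mtotally_bounded_def
  proof (intro allI impI)
    fix \<epsilon> :: real
    assume "\<epsilon> > 0"
    then obtain K where K: "finite K" "K \<subseteq> M" "S \<subseteq> (\<Union>x\<in>K. mball x (\<epsilon>/2))"
      using R half_gt_zero[of \<epsilon>] by meson
    define K' where "K' = {x \<in> K. S \<inter> mball x (\<epsilon>/2) \<noteq> {}}"
    define c where "c x = (SOME y. y \<in> S \<inter> mball x (\<epsilon>/2))" for x
    have c: "c x \<in> S \<inter> mball x (\<epsilon>/2)" if "x \<in> K'" for x
    proof -
      have "\<exists>y. y \<in> S \<inter> mball x (\<epsilon>/2)" using that unfolding K'_def by blast
      then show ?thesis unfolding c_def by (rule someI_ex)
    qed
    have "S \<subseteq> (\<Union>x\<in>c ` K'. mball x \<epsilon>)"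
    proof
      fix s assume s: "s \<in> S"
      then obtain x where x: "x \<in> K" "s \<in> mball x (\<epsilon>/2)" using K by blast
      then have "x \<in> K'" using s by (auto simp: K'_def)
      then have cx: "c x \<in> M" "x \<in> M" "d x (c x) < \<epsilon>/2" "s \<in> M" "d x s < \<epsilon>/2"
        using c[of x] x by auto
      then have "d (c x) s < \<epsilon>"
        using triangle[of "c x" x s] commute[of x "c x"] by linarith
      then have "s \<in> mball (c x) \<epsilon>" using cx by simp
      then show "s \<in> (\<Union>x\<in>c ` K'. mball x \<epsilon>)" using \<open>x \<in> K'\<close> by blast
    qed
    moreover have "finite (c ` K')" using K by (simp add: K'_def)
    moreover have "c ` K' \<subseteq> S" using c by blast
    ultimately show "\<exists>K. finite K \<and> K \<subseteq> S \<and> S \<subseteq> (\<Union>x\<in>K. mball x \<epsilon>)"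
      by (intro exI[of _ "c ` K'"] conjI)
  qed
qed

definition TB_regular_map :: "'a metric \<Rightarrow> 'b metric \<Rightarrow> ('a \<Rightarrow> 'b) \<Rightarrow> bool" where
  "TB_regular_map X Y h \<longleftrightarrow>
     h \<in> mspace X \<rightarrow> mspace Y \<and>
     (\<forall>A. Metric_space.mtotally_bounded (mspace X) (mdist X) A
        \<longrightarrow> Metric_space.mtotally_bounded (mspace Y) (mdist Y) (h ` A))"

definition Cauchy_Lipschitz_map :: "'a metric \<Rightarrow> 'b metric \<Rightarrow> ('a \<Rightarrow> 'b) \<Rightarrow> bool" where
  "Cauchy_Lipschitz_map X Y h \<longleftrightarrow>
     h \<in> mspace X \<rightarrow> mspace Y \<and>
     (\<forall>\<sigma>. Metric_space.MCauchy (mspace X) (mdist X) \<sigma>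
        \<longrightarrow> Lipschitz_continuous_map (submetric X (range \<sigma>)) Y h)"

definition uniformly_locally_Lipschitz_map :: "'a metric \<Rightarrow> 'b metric \<Rightarrow> ('a \<Rightarrow> 'b) \<Rightarrow> bool" where
  "uniformly_locally_Lipschitz_map X Y h \<longleftrightarrow>
     h \<in> mspace X \<rightarrow> mspace Y \<and>
     (\<exists>\<delta>>0. \<forall>x\<in>mspace X. \<exists>k>0. \<forall>u\<in>mball_of X x \<delta>. \<forall>w\<in>mball_of X x \<delta>.
        mdist Y (h u) (h w) \<le> k * mdist X u w)"

end

theory Submission
  imports Defs
begin

text \<open>
  Uniformly locally Lipschitz maps are Cauchy-Lipschitz, Cauchy-Lipschitz maps are
  Cauchy-continuous, and Cauchy-continuous maps are TB-regular. TB-regular maps compose. Hence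
  TB-regularity of \<open>f\<close> gives TB-regularity of \<open>g \<circ> f\<close> for the largest class of \<open>g\<close>, and the
  resulting conditions get weaker as the class of \<open>g\<close> shrinks, down to the real-valued uniformly
  locally Lipschitz functions.

  What makes the circle close is that these last functions already detect total boundedness
  (lemma \<open>not_mtotally_bounded_imp_unbounded_uniformly_locally_Lipschitz_map\<close>): a set \<open>S\<close> that is not
  totally bounded contains a sequence \<open>b\<close> whose terms are pairwise at distance at least some
  \<open>\<epsilon> > 0\<close>. Put on each \<open>b n\<close> a tent of height \<open>n\<close> whose base has radius \<open>\<epsilon>/3\<close>. A ball of radius
  \<open>\<epsilon>/6\<close> meets at most one tent, so the sum of the tents is Lipschitz on each such ball, with a constant
  that depends on the ball, and yet the sum takes every value \<open>n\<close> on \<open>S\<close>.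
  Thus if \<open>f ` A\<close> were not totally bounded for some totally bounded \<open>A\<close>, some \<open>g \<circ> f\<close> would be
  unbounded on \<open>A\<close>.
\<close>

section \<open>The hierarchy of function classes\<close>

lemma TB_regular_map_compose:
  assumes "TB_regular_map X Y f" "TB_regular_map Y Z g"
  shows "TB_regular_map X Z (g \<circ> f)"
  using assms unfolding TB_regular_map_def image_comp [symmetric] by (simp add: Pi_iff)

lemma Cauchy_continuous_imp_TB_regular_map:
  assumes "Cauchy_continuous_map X Y h"
  shows "TB_regular_map X Y h"
  unfolding TB_regular_map_def
  using assms Cauchy_continuous_map_funspace mtotally_bounded_Cauchy_continuous_image by blast

lemma Cauchy_Lipschitz_imp_Cauchy_continuous_map:
  assumes "Cauchy_Lipschitz_map X Y h"
  shows "Cauchy_continuous_map X Y h"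
  unfolding Cauchy_continuous_map_def
proof (intro strip)
  fix \<sigma> assume \<sigma>: "Metric_space.MCauchy (mspace X) (mdist X) \<sigma>"
  then have "Cauchy_continuous_map (submetric X (range \<sigma>)) Y h"
    using assms Lipschitz_imp_Cauchy_continuous_map unfolding Cauchy_Lipschitz_map_def by blast
  moreover have "Metric_space.MCauchy (mspace (submetric X (range \<sigma>))) (mdist X) \<sigma>"
    using \<sigma> Metric_space.MCauchy_def [OF Metric_space_mspace_mdist [of X]]
      Metric_space.MCauchy_def [OF Metric_space_mspace_mdist [of "submetric X (range \<sigma>)"]]
    by auto
  ultimately show "Metric_space.MCauchy (mspace Y) (mdist Y) (h \<circ> \<sigma>)"
    unfolding Cauchy_continuous_map_def by simp
qed

lemma uniformly_locally_Lipschitz_mapE: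
  assumes "uniformly_locally_Lipschitz_map X Y h"
  obtains \<delta> k where "h \<in> mspace X \<rightarrow> mspace Y" "\<delta> > 0" "\<And>x. x \<in> mspace X \<Longrightarrow> k x > 0"
    "\<And>x u w. \<lbrakk>x \<in> mspace X; u \<in> mball_of X x \<delta>; w \<in> mball_of X x \<delta>\<rbrakk>
       \<Longrightarrow> mdist Y (h u) (h w) \<le> k x * mdist X u w"
proof -
  obtain \<delta> where im: "h \<in> mspace X \<rightarrow> mspace Y" and "\<delta> > 0"
    and "\<forall>x\<in>mspace X. \<exists>k>0. \<forall>u\<in>mball_of X x \<delta>. \<forall>w\<in>mball_of X x \<delta>.
           mdist Y (h u) (h w) \<le> k * mdist X u w"
    using assms unfolding uniformly_locally_Lipschitz_map_def by (elim conjE exE)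
  from bchoice [OF this(3)] obtain k where
    "\<forall>x\<in>mspace X. k x > 0 \<and> (\<forall>u\<in>mball_of X x \<delta>. \<forall>w\<in>mball_of X x \<delta>.
       mdist Y (h u) (h w) \<le> k x * mdist X u w)" ..
  with im \<open>\<delta> > 0\<close> show thesis
    by (intro that [of \<delta> k]) (simp_all del: in_mball_of)
qed

lemma uniformly_locally_Lipschitz_imp_Cauchy_continuous_map:
  assumes "uniformly_locally_Lipschitz_map X Y h"
  shows "Cauchy_continuous_map X Y h"
proof -
  obtain \<delta> k where im: "h \<in> mspace X \<rightarrow> mspace Y" and "\<delta> > 0"
    and k: "\<And>x u w. \<lbrakk>x \<in> mspace X; u \<in> mball_of X x \<delta>; w \<in> mball_of X x \<delta>\<rbrakk>
              \<Longrightarrow> mdist Y (h u) (h w) \<le> k x * mdist X u w"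
    using uniformly_locally_Lipschitz_mapE [OF assms] by metis
  have "Lipschitz_continuous_map (submetric X (mball_of X x \<delta>)) Y h" if "x \<in> mspace X" for x
    unfolding Lipschitz_continuous_map_def mspace_submetric mdist_submetric
    using k [OF that] im by blast
  then show ?thesis
    by (rule locally_Cauchy_continuous_map [OF \<open>\<delta> > 0\<close> Lipschitz_imp_Cauchy_continuous_map])
qed

text \<open>
  Cover \<open>S\<close> by finitely many balls of half the radius that works uniformly. Points of \<open>S\<close> at distance
  less than this half radius lie in one of the enlarged balls, so the largest of finitely many
  local constants serves. For points further apart a constant exists because \<open>h ` S\<close> is bounded.
\<close>

lemma uniformly_locally_Lipschitz_imp_Lipschitz_on_mtotally_bounded:
  assumes h: "uniformly_locally_Lipschitz_map X Y h"
    and S: "Metric_space.mtotally_bounded (mspace X) (mdist X) S"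
  shows "Lipschitz_continuous_map (submetric X S) Y h"
proof -
  interpret X: Metric_space "mspace X" "mdist X" by simp
  interpret Y: Metric_space "mspace Y" "mdist Y" by simp
  obtain \<delta> k where im: "h \<in> mspace X \<rightarrow> mspace Y" and "\<delta> > 0"
    and kpos: "\<And>x. x \<in> mspace X \<Longrightarrow> k x > 0"
    and k: "\<And>x u w. \<lbrakk>x \<in> mspace X; u \<in> mball_of X x \<delta>; w \<in> mball_of X x \<delta>\<rbrakk>
              \<Longrightarrow> mdist Y (h u) (h w) \<le> k x * mdist X u w"
    using uniformly_locally_Lipschitz_mapE [OF h] by metis
  have SX: "S \<subseteq> mspace X" using S X.mtotally_bounded_imp_subset by blast
  have "\<delta>/2 > 0" using \<open>\<delta> > 0\<close> by simp
  then obtain K where K: "finite K" "K \<subseteq> S" "S \<subseteq> (\<Union>x\<in>K. X.mball x (\<delta>/2))"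
    using S unfolding X.mtotally_bounded_def by meson
  have "Y.mtotally_bounded (h ` S)"
    using mtotally_bounded_Cauchy_continuous_image
      [OF uniformly_locally_Lipschitz_imp_Cauchy_continuous_map [OF h] S] .
  then have "Y.mbounded (h ` S)"
    by (rule Y.mtotally_bounded_imp_mbounded)
  then obtain D where "D > 0" and D: "\<And>u w. \<lbrakk>u \<in> S; w \<in> S\<rbrakk> \<Longrightarrow> mdist Y (h u) (h w) \<le> D"
    unfolding Y.mbounded_alt_pos by blast
  have ksum: "k c \<le> sum k K" if "c \<in> K" for c
    using K SX kpos that by (intro member_le_sum) (auto intro!: less_imp_le)
  have "sum k K \<ge> 0"
    using K SX kpos by (intro sum_nonneg) (auto intro!: less_imp_le)
  define B where "B = sum k K + D / (\<delta>/2)"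
  have "mdist Y (h u) (h w) \<le> B * mdist X u w" if uw: "u \<in> S" "w \<in> S" for u w
  proof (cases "mdist X u w < \<delta>/2")
    case True
    obtain c where c: "c \<in> K" "u \<in> X.mball c (\<delta>/2)"
      using K uw by blast
    then have "c \<in> mspace X" "u \<in> mspace X" "w \<in> mspace X" "mdist X c u < \<delta>/2"
      using K SX uw by auto
    moreover have "mdist X c w < \<delta>"
      using X.triangle [of c u w] calculation True by linarith
    ultimately have "mdist Y (h u) (h w) \<le> k c * mdist X u w"
      using \<open>\<delta> > 0\<close> by (intro k) auto
    also have "\<dots> \<le> B * mdist X u w"
      using ksum [OF c(1)] \<open>D > 0\<close> \<open>\<delta> > 0\<close> by (intro mult_right_mono) (auto simp: B_def intro: add_increasing2)
    finally show ?thesis .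
  next
    case False
    have "mdist Y (h u) (h w) \<le> D / (\<delta>/2) * (\<delta>/2)"
      using D [OF uw] \<open>\<delta> > 0\<close> by simp
    also have "\<dots> \<le> B * mdist X u w"
      using False \<open>sum k K \<ge> 0\<close> \<open>D > 0\<close> \<open>\<delta> > 0\<close> by (intro mult_mono) (auto simp: B_def)
    finally show ?thesis .
  qed
  then show ?thesis
    using im by (auto simp: Lipschitz_continuous_map_def)
qed

lemma uniformly_locally_Lipschitz_imp_Cauchy_Lipschitz_map:
  assumes "uniformly_locally_Lipschitz_map X Y h"
  shows "Cauchy_Lipschitz_map X Y h"
  unfolding Cauchy_Lipschitz_map_def
proof (intro conjI strip)
  show "h \<in> mspace X \<rightarrow> mspace Y"
    using assms by (simp add: uniformly_locally_Lipschitz_map_def)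
next
  fix \<sigma> assume "Metric_space.MCauchy (mspace X) (mdist X) \<sigma>"
  then have "Metric_space.mtotally_bounded (mspace X) (mdist X) (range \<sigma>)"
    by (simp add: Metric_space.mtotally_bounded_cauchy_sequence)
  with assms show "Lipschitz_continuous_map (submetric X (range \<sigma>)) Y h"
    by (rule uniformly_locally_Lipschitz_imp_Lipschitz_on_mtotally_bounded)
qed

lemma uniformly_locally_Lipschitz_map_compose_Lipschitz:
  assumes h: "uniformly_locally_Lipschitz_map X Y h" and g: "Lipschitz_continuous_map Y Z g"
  shows "uniformly_locally_Lipschitz_map X Z (g \<circ> h)"
proof -
  obtain \<delta> k where im: "h \<in> mspace X \<rightarrow> mspace Y" and "\<delta> > 0"
    and kpos: "\<And>x. x \<in> mspace X \<Longrightarrow> k x > 0"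
    and k: "\<And>x u w. \<lbrakk>x \<in> mspace X; u \<in> mball_of X x \<delta>; w \<in> mball_of X x \<delta>\<rbrakk>
              \<Longrightarrow> mdist Y (h u) (h w) \<le> k x * mdist X u w"
    using uniformly_locally_Lipschitz_mapE [OF h] by metis
  obtain B where gim: "g \<in> mspace Y \<rightarrow> mspace Z" and "B > 0"
    and B: "\<And>x y. \<lbrakk>x \<in> mspace Y; y \<in> mspace Y\<rbrakk> \<Longrightarrow> mdist Z (g x) (g y) \<le> B * mdist Y x y"
    using g unfolding Lipschitz_continuous_map_pos by blast
  have "mdist Z (g (h u)) (g (h w)) \<le> B * k x * mdist X u w"
    if "x \<in> mspace X" "u \<in> mball_of X x \<delta>" "w \<in> mball_of X x \<delta>" for x u w
  proof -
    have "mdist Z (g (h u)) (g (h w)) \<le> B * mdist Y (h u) (h w)"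
      using im that by (intro B) auto
    also have "\<dots> \<le> B * (k x * mdist X u w)"
      using k [OF that] \<open>B > 0\<close> by simp
    finally show ?thesis by (simp add: mult.assoc)
  qed
  moreover have "B * k x > 0" if "x \<in> mspace X" for x
    using kpos [OF that] \<open>B > 0\<close> by simp
  ultimately have "\<exists>k>0. \<forall>u\<in>mball_of X x \<delta>. \<forall>w\<in>mball_of X x \<delta>.
      mdist Z ((g \<circ> h) u) ((g \<circ> h) w) \<le> k * mdist X u w" if "x \<in> mspace X" for x
    using that by (intro exI [of _ "B * k x"]) (simp del: in_mball_of)
  then show ?thesis
    unfolding uniformly_locally_Lipschitz_map_def using \<open>\<delta> > 0\<close> im gim
    by (intro conjI exI [of _ \<delta>]) (auto simp del: in_mball_of)
qed

section \<open>Real-valued functions detect total boundedness\<close>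

text \<open>
  Choose greedily: if no finite union of \<open>\<epsilon>\<close>-balls centred in \<open>S\<close> covers \<open>S\<close>, there is always a
  next point outside the balls around the points chosen so far.
\<close>

lemma (in Metric_space) not_mtotally_bounded_imp_separated_sequence:
  assumes "S \<subseteq> M" "\<not> mtotally_bounded S"
  obtains \<epsilon> :: real and b :: "nat \<Rightarrow> 'a"
  where "\<epsilon> > 0" "range b \<subseteq> S" "\<And>m n. m \<noteq> n \<Longrightarrow> \<epsilon> \<le> d (b m) (b n)"
proof -
  obtain \<epsilon> where "\<epsilon> > 0" and \<epsilon>: "\<And>K. \<lbrakk>finite K; K \<subseteq> S\<rbrakk> \<Longrightarrow> \<not> S \<subseteq> (\<Union>x\<in>K. mball x \<epsilon>)"
    using assms(2) unfolding mtotally_bounded_def by meson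
  have "\<exists>b. \<forall>n::nat. b n \<in> S \<and> (\<forall>m<n. \<epsilon> \<le> d (b m) (b n))"
  proof (rule dependent_wellorder_choice)
    fix n :: nat and b
    assume b: "\<And>m. m < n \<Longrightarrow> b m \<in> S \<and> (\<forall>i<m. \<epsilon> \<le> d (b i) (b m))"
    then have "\<not> S \<subseteq> (\<Union>x\<in>b ` {..<n}. mball x \<epsilon>)"
      by (intro \<epsilon>) auto
    then obtain y where y: "y \<in> S" "\<And>m. m < n \<Longrightarrow> y \<notin> mball (b m) \<epsilon>"
      by blast
    have "\<epsilon> \<le> d (b m) y" if "m < n" for m
    proof -
      have "b m \<in> M" "y \<in> M"
        using b [OF that] y(1) \<open>S \<subseteq> M\<close> by auto
      then show ?thesis
        using y(2) [OF that] by simp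
    qed
    with y(1) show "\<exists>y. y \<in> S \<and> (\<forall>m<n. \<epsilon> \<le> d (b m) y)"
      by blast
  qed auto
  then obtain b where b: "\<And>n::nat. b n \<in> S" "\<And>m n. m < n \<Longrightarrow> \<epsilon> \<le> d (b m) (b n)"
    by blast
  have "\<epsilon> \<le> d (b m) (b n)" if "m \<noteq> n" for m n
    using that b(2) [of m n] b(2) [of n m] commute [of "b m" "b n"] by (cases "m < n") auto
  with that \<open>\<epsilon> > 0\<close> b show thesis by blast
qed

lemma not_mtotally_bounded_imp_unbounded_uniformly_locally_Lipschitz_map:
  assumes S: "S \<subseteq> mspace Y" "\<not> Metric_space.mtotally_bounded (mspace Y) (mdist Y) S"
  obtains g :: "'b \<Rightarrow> real"
  where "uniformly_locally_Lipschitz_map Y euclidean_metric g" "\<not> bounded (g ` S)"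
proof -
  interpret Y: Metric_space "mspace Y" "mdist Y" by simp
  obtain \<epsilon> b where "\<epsilon> > 0" and bS: "range b \<subseteq> S"
    and sep: "\<And>m n::nat. m \<noteq> n \<Longrightarrow> \<epsilon> \<le> mdist Y (b m) (b n)"
    using Y.not_mtotally_bounded_imp_separated_sequence [OF S] by metis
  have bY: "b n \<in> mspace Y" for n
    using bS S by blast
  define r where "r = \<epsilon>/3"
  have "r > 0" using \<open>\<epsilon> > 0\<close> by (simp add: r_def)
  \<comment> \<open>At each point the sum has at most one term, so its value is the height of the only tent there.\<close>
  define g where "g y = (\<Sum>n | mdist Y (b n) y < r. real n * (1 - mdist Y (b n) y / r))" for y
  define tent where "tent n y = real n * max 0 (1 - mdist Y (b n) y / r)" for n y
  have local_tent: "\<exists>N. \<forall>u\<in>mball_of Y x (r/2). g u = tent N u" if x: "x \<in> mspace Y" for x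
  proof (cases "\<exists>n. \<exists>w\<in>mball_of Y x (r/2). mdist Y (b n) w < r")
    case True
    then obtain n w where w: "w \<in> mball_of Y x (r/2)" and nw: "mdist Y (b n) w < r"
      by blast
    have "g u = tent n u" if u: "u \<in> mball_of Y x (r/2)" for u
    proof -
      have "m = n" if m: "mdist Y (b m) u < r" for m
      proof (rule ccontr)
        assume "m \<noteq> n"
        then have "3 * r \<le> mdist Y (b m) (b n)"
          using sep by (simp add: r_def)
        also have "\<dots> \<le> mdist Y (b m) u + mdist Y u (b n)"
          using u by (intro Y.triangle) (auto simp: bY)
        also have "mdist Y u (b n) \<le> mdist Y u w + mdist Y w (b n)"
          using u w by (intro Y.triangle) (auto simp: bY)
        also have "mdist Y u w \<le> mdist Y u x + mdist Y x w"
          using u w by (intro Y.triangle) auto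
        finally show False
          using m nw u w by (simp add: Y.commute)
      qed
      then have eq: "{m. mdist Y (b m) u < r} = {m. m = n \<and> mdist Y (b n) u < r}"
        by blast
      show ?thesis
        unfolding g_def tent_def eq using \<open>r > 0\<close>
        by (cases "mdist Y (b n) u < r") (auto simp: max_def field_simps)
    qed
    then show ?thesis by blast
  next
    case False
    then have "g u = tent 0 u" if "u \<in> mball_of Y x (r/2)" for u
      using that unfolding g_def tent_def by (intro trans [OF sum.neutral]) auto
    then show ?thesis by blast
  qed
  \<comment> \<open>The summand 1 keeps the constant positive for \<open>n = 0\<close>, as the local Lipschitz condition demands.\<close>
  have tent_Lipschitz: "\<bar>tent n u - tent n w\<bar> \<le> (real n / r + 1) * mdist Y u w"
    if "u \<in> mspace Y" "w \<in> mspace Y" for n u w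
  proof -
    have "\<bar>mdist Y (b n) u - mdist Y (b n) w\<bar> \<le> mdist Y u w"
      using Y.triangle [of "b n" u w] Y.triangle [of "b n" w u] Y.commute [of u w] bY that
      by (simp add: abs_le_iff)
    moreover have "\<bar>max 0 (1 - s/r) - max 0 (1 - t/r)\<bar> \<le> \<bar>s - t\<bar> / r" for s t
    proof -
      have "\<bar>max 0 (1 - s/r) - max 0 (1 - t/r)\<bar> \<le> \<bar>s/r - t/r\<bar>"
        by linarith
      also have "\<dots> = \<bar>s - t\<bar> / r"
        using \<open>r > 0\<close> by (simp add: diff_divide_distrib [symmetric])
      finally show ?thesis .
    qed
    ultimately have "\<bar>max 0 (1 - mdist Y (b n) u / r) - max 0 (1 - mdist Y (b n) w / r)\<bar>
        \<le> mdist Y u w / r"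
      using \<open>r > 0\<close> by (meson divide_right_mono less_imp_le order_trans)
    then have "real n * \<bar>max 0 (1 - mdist Y (b n) u / r) - max 0 (1 - mdist Y (b n) w / r)\<bar>
        \<le> real n * (mdist Y u w / r)"
      by (intro mult_left_mono) auto
    then have "\<bar>tent n u - tent n w\<bar> \<le> real n / r * mdist Y u w"
      by (simp add: tent_def abs_mult flip: right_diff_distrib)
    also have "\<dots> \<le> (real n / r + 1) * mdist Y u w"
      by (intro mult_right_mono) auto
    finally show ?thesis .
  qed
  have "\<exists>k>0. \<forall>u\<in>mball_of Y x (r/2). \<forall>w\<in>mball_of Y x (r/2). dist (g u) (g w) \<le> k * mdist Y u w"
    if x: "x \<in> mspace Y" for x
  proof -
    obtain N where N: "\<And>u. u \<in> mball_of Y x (r/2) \<Longrightarrow> g u = tent N u"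
      using local_tent [OF x] by blast
    have "dist (g u) (g w) \<le> (real N / r + 1) * mdist Y u w"
      if "u \<in> mball_of Y x (r/2)" "w \<in> mball_of Y x (r/2)" for u w
      using that tent_Lipschitz [of u w N] N by (simp add: dist_real_def)
    moreover have "real N / r + 1 > 0"
      using \<open>r > 0\<close> by (simp add: add_nonneg_pos)
    ultimately show ?thesis by blast
  qed
  then have "uniformly_locally_Lipschitz_map Y euclidean_metric g"
    unfolding uniformly_locally_Lipschitz_map_def mdist_euclidean_metric mspace_euclidean_metric
    using \<open>r > 0\<close> by (intro conjI exI [of _ "r/2"]) (auto simp del: in_mball_of)
  moreover have "g (b n) = real n" for n
  proof -
    have "{m. mdist Y (b m) (b n) < r} = {n}"
      using sep [of _ n] \<open>\<epsilon> > 0\<close> bY by (force simp: r_def)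
    then show ?thesis
      using bY by (simp add: g_def)
  qed
  then have "\<exists>y\<in>S. \<not> \<bar>g y\<bar> \<le> B" for B
    using bS reals_Archimedean2 [of B] by (metis abs_of_nat not_le range_subsetD)
  then have "\<not> bounded (g ` S)"
    by (simp add: bounded_real)
  ultimately show thesis by (rule that)
qed

section \<open>The characterization\<close>

text \<open>
  The image of a totally bounded set under a TB-regular real function is bounded, so the preceding
  functions leave no room for a non-totally-bounded image.
\<close>

lemma TB_regular_map_if_real_compositions:
  assumes f: "f \<in> mspace X \<rightarrow> mspace Y"
    and comp: "\<And>g :: 'b \<Rightarrow> real. uniformly_locally_Lipschitz_map Y euclidean_metric g
                 \<Longrightarrow> TB_regular_map X euclidean_metric (g \<circ> f)"
  shows "TB_regular_map X Y f"
  unfolding TB_regular_map_def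
proof (intro conjI strip f)
  fix A assume A: "Metric_space.mtotally_bounded (mspace X) (mdist X) A"
  show "Metric_space.mtotally_bounded (mspace Y) (mdist Y) (f ` A)"
  proof (rule ccontr)
    assume notTB: "\<not> Metric_space.mtotally_bounded (mspace Y) (mdist Y) (f ` A)"
    have "A \<subseteq> mspace X"
      using A Metric_space.mtotally_bounded_imp_subset [OF Metric_space_mspace_mdist] by blast
    then have "f ` A \<subseteq> mspace Y"
      using f by blast
    then obtain g :: "'b \<Rightarrow> real"
      where g: "uniformly_locally_Lipschitz_map Y euclidean_metric g" "\<not> bounded (g ` f ` A)"
      using notTB by (rule not_mtotally_bounded_imp_unbounded_uniformly_locally_Lipschitz_map)
    have "Met_TC.mtotally_bounded ((g \<circ> f) ` A)"
      using comp [OF g(1)] A unfolding TB_regular_map_def by simp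
    then have "bounded (g ` f ` A)"
      using Met_TC.mtotally_bounded_imp_mbounded by (auto simp: image_comp)
    with g show False by blast
  qed
qed

text \<open>
  An isometric copy of the real line in the type over which the codomains \<open>Z\<close> range; it lets
  real-valued test functions be treated as maps into such a \<open>Z\<close>.
\<close>

definition Inr_real_metric :: "('z + real) metric" where
  "Inr_real_metric = metric (range Inr, \<lambda>x y. dist (projr x) (projr y))"

lemma Inr_real_metric_simps [simp]:
  "mspace Inr_real_metric = range Inr"
  "mdist Inr_real_metric x y = dist (projr x) (projr y)"
proof -
  interpret Metric_space "range Inr :: ('z + real) set" "\<lambda>x y. dist (projr x) (projr y)"
    by unfold_locales (auto simp: dist_commute dist_triangle)
  show "mspace Inr_real_metric = (range Inr :: ('z + real) set)"
    by (simp add: Inr_real_metric_def)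
  show "mdist Inr_real_metric x y = dist (projr x) (projr y)" for x y :: "'z + real"
    by (simp add: Inr_real_metric_def)
qed

lemma Lipschitz_continuous_map_Inr: "Lipschitz_continuous_map euclidean_metric Inr_real_metric Inr"
  unfolding Lipschitz_continuous_map_def by (auto intro!: exI [of _ 1])

lemma Lipschitz_continuous_map_projr: "Lipschitz_continuous_map Inr_real_metric euclidean_metric projr"
  unfolding Lipschitz_continuous_map_def by (auto intro!: exI [of _ 1])

text \<open>
  Both directions of the isometry are Lipschitz, so \<open>g\<close> can be carried into the copy of the line without
  leaving its class, and the resulting TB-regularity can be carried back.
\<close>

lemma TB_regular_real_compositions_if_sum_compositions:
  fixes g :: "'b \<Rightarrow> real"
  assumes comp: "\<And>(Z :: ('z + real) metric) g. uniformly_locally_Lipschitz_map Y Z g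
                 \<Longrightarrow> TB_regular_map X Z (g \<circ> f)"
    and g: "uniformly_locally_Lipschitz_map Y euclidean_metric g"
  shows "TB_regular_map X euclidean_metric (g \<circ> f)"
proof -
  let ?i = "Inr :: real \<Rightarrow> 'z + real"
  have "TB_regular_map X Inr_real_metric ((?i \<circ> g) \<circ> f)"
    by (intro comp uniformly_locally_Lipschitz_map_compose_Lipschitz [OF g] Lipschitz_continuous_map_Inr)
  moreover have "TB_regular_map Inr_real_metric euclidean_metric (projr :: 'z + real \<Rightarrow> real)"
    by (intro Cauchy_continuous_imp_TB_regular_map Lipschitz_imp_Cauchy_continuous_map
        Lipschitz_continuous_map_projr)
  ultimately have "TB_regular_map X euclidean_metric (projr \<circ> ((?i \<circ> g) \<circ> f))"
    by (rule TB_regular_map_compose)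
  then show ?thesis by (simp add: comp_def)
qed

theorem theorem4:
  fixes X :: "'a metric" and Y :: "'b metric" and f :: "'a \<Rightarrow> 'b"
  assumes "f \<in> mspace X \<rightarrow> mspace Y"
  shows
    "(TB_regular_map X Y f \<longleftrightarrow>
        (\<forall>(Z :: ('z + real) metric) g. TB_regular_map Y Z g \<longrightarrow> TB_regular_map X Z (g \<circ> f))) \<and>
     (TB_regular_map X Y f \<longleftrightarrow>
        (\<forall>(Z :: ('z + real) metric) g. Cauchy_continuous_map Y Z g \<longrightarrow> TB_regular_map X Z (g \<circ> f))) \<and>
     (TB_regular_map X Y f \<longleftrightarrow>
        (\<forall>(Z :: ('z + real) metric) g. Cauchy_Lipschitz_map Y Z g \<longrightarrow> TB_regular_map X Z (g \<circ> f))) \<and>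
     (TB_regular_map X Y f \<longleftrightarrow>
        (\<forall>(Z :: ('z + real) metric) g. uniformly_locally_Lipschitz_map Y Z g \<longrightarrow> TB_regular_map X Z (g \<circ> f))) \<and>
     (TB_regular_map X Y f \<longleftrightarrow>
        (\<forall>g :: 'b \<Rightarrow> real. uniformly_locally_Lipschitz_map Y euclidean_metric g \<longrightarrow>
           TB_regular_map X euclidean_metric (g \<circ> f)))"
proof -
  let ?a = "TB_regular_map X Y f"
  let ?b = "\<forall>(Z :: ('z + real) metric) g. TB_regular_map Y Z g \<longrightarrow> TB_regular_map X Z (g \<circ> f)"
  let ?c = "\<forall>(Z :: ('z + real) metric) g. Cauchy_continuous_map Y Z g \<longrightarrow> TB_regular_map X Z (g \<circ> f)"
  let ?d = "\<forall>(Z :: ('z + real) metric) g. Cauchy_Lipschitz_map Y Z g \<longrightarrow> TB_regular_map X Z (g \<circ> f)"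
  let ?e = "\<forall>(Z :: ('z + real) metric) g. uniformly_locally_Lipschitz_map Y Z g
              \<longrightarrow> TB_regular_map X Z (g \<circ> f)"
  let ?f = "\<forall>g :: 'b \<Rightarrow> real. uniformly_locally_Lipschitz_map Y euclidean_metric g
              \<longrightarrow> TB_regular_map X euclidean_metric (g \<circ> f)"
  have "?a \<Longrightarrow> ?b"
    using TB_regular_map_compose by blast
  moreover have "?b \<Longrightarrow> ?c"
    using Cauchy_continuous_imp_TB_regular_map by blast
  moreover have "?c \<Longrightarrow> ?d"
    using Cauchy_Lipschitz_imp_Cauchy_continuous_map by blast
  moreover have "?d \<Longrightarrow> ?e"
    using uniformly_locally_Lipschitz_imp_Cauchy_Lipschitz_map by blast
  moreover have "?e \<Longrightarrow> ?f"
    using TB_regular_real_compositions_if_sum_compositions [where 'z = 'z and X = X and Y = Y and f = f] by blast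
  moreover have "?f \<Longrightarrow> ?a"
    using TB_regular_map_if_real_compositions [OF assms] by blast
  ultimately show ?thesis by argo
qed

end
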